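(* Let $\alpha\in(2,\infty)$ and let $0<c<2^{2-\alpha}\alpha$. For $M\ge c$ with $M>0$ set $q:=c/M$ and $p:=1-q$, and let $X_M,Y_M$ be i.i.d. real-valued random variables with $$\mathbb{P}(X_M=1)=\mathbb{P}(Y_M=1)=p,\qquad \mathbb{P}(X_M=-M)=\mathbb{P}(Y_M=-M)=q.$$ Then for all sufficiently large $M$, $$\mathbb{E}|X_M-Y_M|^\alpha-\mathbb{E}|X_M+Y_M|^\alpha>0.$$ In particular, for every $\alpha\in(2,\infty)$ the inequality $\mathbb{E}|X-Y|^\alpha\le\mathbb{E}|X+Y|^\alpha$ fails for some pair of i.i.d. real random variables $X,Y$ with $\mathbb{E}|X|^\alpha<\infty$. *)

theory Defs
  imports "HOL-Probability.Probability"
begin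

(* Measurability of X and Y is part of indep_var. *)
definition iid_pair :: "'a measure \<Rightarrow> ('a \<Rightarrow> real) \<Rightarrow> ('a \<Rightarrow> real) \<Rightarrow> bool" where
  "iid_pair \<Omega> X Y \<longleftrightarrow>
     prob_space \<Omega> \<and> prob_space.indep_var \<Omega> borel X borel Y \<and>
     distr \<Omega> borel X = distr \<Omega> borel Y"

definition two_point_law :: "'a measure \<Rightarrow> real \<Rightarrow> real \<Rightarrow> ('a \<Rightarrow> real) \<Rightarrow> bool" where
  "two_point_law \<Omega> c M X \<longleftrightarrow>
     (let q = c / M; p = 1 - q in
        \<P>(\<omega> in \<Omega>. X \<omega> = 1) = p \<and> \<P>(\<omega> in \<Omega>. X \<omega> = - M) = q)"

end

theory Submission
  imports Defs "HOL-Real_Asymp.Real_Asymp"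
begin

text \<open>
  Write \<open>q = c / M\<close> and \<open>p = 1 - q\<close>. Independence turns both moments into finite sums over the four
  joint values. In the difference \<open>X - Y\<close> the two diagonal values vanish, so
  \[ E|X-Y|^\alpha - E|X+Y|^\alpha
       = 2 p q \bigl((M+1)^\alpha - (M-1)^\alpha\bigr) - p^2 2^\alpha - q^2 (2M)^\alpha . \]
  By the mean value theorem the first term grows like \<open>4 \<alpha> c M powr (\<alpha> - 2)\<close>. The last one equals
  \<open>c\<^sup>2 2 powr \<alpha> M powr (\<alpha> - 2)\<close>, and the middle one stays bounded, hence is negligible
  because \<open>\<alpha> > 2\<close>. Thus the leading coefficient is \<open>c (4 \<alpha> - c 2 powr \<alpha>)\<close>, which is positive exactly
  in the range \<open>0 < c < 2 powr (2 - \<alpha>) * \<alpha>\<close>.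
  The lemma \<open>expectation_two_point_pair\<close> gives the finite sums and \<open>eventually_moment_gap_pos\<close>
  the asymptotics. For the counterexample, the coordinate projections on a product measure
  realise an i.i.d. pair with any prescribed law.
\<close>

section \<open>Expectations under a two-point law\<close>

text \<open>
  The two stated probabilities add up to one, so there is no mass elsewhere; positivity of \<open>M\<close>
  keeps the two values distinct.
\<close>
lemma two_point_law_AE:
  assumes "prob_space \<Omega>" and [measurable]: "X \<in> borel_measurable \<Omega>"
    and law: "two_point_law \<Omega> c M X" and "M > 0"
  shows "AE \<omega> in \<Omega>. X \<omega> = 1 \<or> X \<omega> = - M"
proof -
  interpret prob_space \<Omega> by fact
  let ?A = "{\<omega> \<in> space \<Omega>. X \<omega> = 1}" and ?B = "{\<omega> \<in> space \<Omega>. X \<omega> = - M}"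
  have "?A \<inter> ?B = {}" using \<open>M > 0\<close> by auto
  then have "prob (?A \<union> ?B) = prob ?A + prob ?B"
    by (intro finite_measure_Union) auto
  also have "\<dots> = 1" using law by (simp add: two_point_law_def Let_def)
  finally have "AE \<omega> in \<Omega>. \<omega> \<in> ?A \<union> ?B"
    by (intro AE_prob_1)
  then show ?thesis by eventually_elim auto
qed

lemma expectation_two_point_pair:
  fixes g :: "real \<Rightarrow> real \<Rightarrow> real"
  assumes iid: "iid_pair \<Omega> X Y"
    and lawX: "two_point_law \<Omega> c M X" and lawY: "two_point_law \<Omega> c M Y" and "M > 0"
    and p: "p = 1 - c / M" and q: "q = c / M"
    and [measurable]: "case_prod g \<in> borel_measurable (borel \<Otimes>\<^sub>M borel)"
  shows "(\<integral>\<omega>. g (X \<omega>) (Y \<omega>) \<partial>\<Omega>)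
       = p\<^sup>2 * g 1 1 + p * q * (g 1 (- M) + g (- M) 1) + q\<^sup>2 * g (- M) (- M)"
proof -
  from iid have ps: "prob_space \<Omega>" by (simp add: iid_pair_def)
  then interpret prob_space \<Omega> .
  from iid have ind: "indep_var borel X borel Y" by (simp add: iid_pair_def)
  have mX [measurable]: "X \<in> borel_measurable \<Omega>" and mY [measurable]: "Y \<in> borel_measurable \<Omega>"
    using indep_var_rv1[OF ind] indep_var_rv2[OF ind] by auto
  have X: "prob {\<omega> \<in> space \<Omega>. X \<omega> = 1} = p" "prob {\<omega> \<in> space \<Omega>. X \<omega> = - M} = q"
    using lawX by (simp_all add: two_point_law_def Let_def p q)
  have Y: "prob {\<omega> \<in> space \<Omega>. Y \<omega> = 1} = p" "prob {\<omega> \<in> space \<Omega>. Y \<omega> = - M} = q"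
    using lawY by (simp_all add: two_point_law_def Let_def p q)
  define E where "E x y = {\<omega> \<in> space \<Omega>. X \<omega> = x \<and> Y \<omega> = y}" for x y
  have E_sets [measurable]: "E x y \<in> events" for x y unfolding E_def by measurable
  have E_prob: "prob (E x y) = prob {\<omega> \<in> space \<Omega>. X \<omega> = x} * prob {\<omega> \<in> space \<Omega>. Y \<omega> = y}" for x y
    using prob_indep_random_variable[OF ind, of "{x}" "{y}"] by (simp add: E_def)
  let ?s = "\<lambda>\<omega>. g 1 1 * indicator (E 1 1) \<omega> + g 1 (- M) * indicator (E 1 (- M)) \<omega>
              + g (- M) 1 * indicator (E (- M) 1) \<omega> + g (- M) (- M) * indicator (E (- M) (- M)) \<omega>"
  have "AE \<omega> in \<Omega>. g (X \<omega>) (Y \<omega>) = ?s \<omega>"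
    using two_point_law_AE[OF ps mX lawX \<open>M > 0\<close>] two_point_law_AE[OF ps mY lawY \<open>M > 0\<close>] AE_space
  proof eventually_elim
    case (elim \<omega>)
    then show ?case using \<open>M > 0\<close> by (auto simp: E_def indicator_def)
  qed
  then have "(\<integral>\<omega>. g (X \<omega>) (Y \<omega>) \<partial>\<Omega>) = (\<integral>\<omega>. ?s \<omega> \<partial>\<Omega>)"
    by (intro integral_cong_AE) measurable
  also have "\<dots> = g 1 1 * prob (E 1 1) + g 1 (- M) * prob (E 1 (- M))
                + g (- M) 1 * prob (E (- M) 1) + g (- M) (- M) * prob (E (- M) (- M))"
    by (simp add: emeasure_eq_measure)
  also have "\<dots> = p\<^sup>2 * g 1 1 + p * q * (g 1 (- M) + g (- M) 1) + q\<^sup>2 * g (- M) (- M)"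
    by (simp add: E_prob X Y power2_eq_square algebra_simps)
  finally show ?thesis .
qed

section \<open>The moment gap for large \<open>M\<close>\<close>

definition moment_gap :: "real \<Rightarrow> real \<Rightarrow> real \<Rightarrow> real" where
  "moment_gap \<alpha> c M =
     2 * (1 - c / M) * (c / M) * ((M + 1) powr \<alpha> - (M - 1) powr \<alpha>)
       - (1 - c / M)\<^sup>2 * 2 powr \<alpha> - (c / M)\<^sup>2 * (2 * M) powr \<alpha>"

lemma moment_gap_eq:
  assumes iid: "iid_pair \<Omega> X Y"
    and law: "two_point_law \<Omega> c M X" "two_point_law \<Omega> c M Y" and "M \<ge> 1"
  shows "(\<integral>\<omega>. \<bar>X \<omega> - Y \<omega>\<bar> powr \<alpha> \<partial>\<Omega>) - (\<integral>\<omega>. \<bar>X \<omega> + Y \<omega>\<bar> powr \<alpha> \<partial>\<Omega>) = moment_gap \<alpha> c M"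
proof -
  have "M > 0" using \<open>M \<ge> 1\<close> by simp
  note formula = expectation_two_point_pair[OF iid law \<open>M > 0\<close> refl refl]
  have diff: "(\<integral>\<omega>. \<bar>X \<omega> - Y \<omega>\<bar> powr \<alpha> \<partial>\<Omega>)
      = (1 - c / M)\<^sup>2 * \<bar>1 - 1\<bar> powr \<alpha>
        + (1 - c / M) * (c / M) * (\<bar>1 - (- M)\<bar> powr \<alpha> + \<bar>- M - 1\<bar> powr \<alpha>)
        + (c / M)\<^sup>2 * \<bar>- M - (- M)\<bar> powr \<alpha>"
    by (rule formula) measurable
  have sum: "(\<integral>\<omega>. \<bar>X \<omega> + Y \<omega>\<bar> powr \<alpha> \<partial>\<Omega>)
      = (1 - c / M)\<^sup>2 * \<bar>1 + 1\<bar> powr \<alpha>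
        + (1 - c / M) * (c / M) * (\<bar>1 + (- M)\<bar> powr \<alpha> + \<bar>- M + 1\<bar> powr \<alpha>)
        + (c / M)\<^sup>2 * \<bar>- M + (- M)\<bar> powr \<alpha>"
    by (rule formula) measurable
  have vals: "\<bar>1 - 1 :: real\<bar> = 0" "\<bar>1 - (- M)\<bar> = M + 1" "\<bar>- M - 1\<bar> = M + 1" "\<bar>- M - (- M)\<bar> = 0"
      "\<bar>1 + 1 :: real\<bar> = 2" "\<bar>1 + (- M)\<bar> = M - 1" "\<bar>- M + 1\<bar> = M - 1" "\<bar>- M + (- M)\<bar> = 2 * M"
    using \<open>M \<ge> 1\<close> by auto
  have "0 powr \<alpha> = (0 :: real)" by simp
  then show ?thesis
    unfolding diff sum vals moment_gap_def by algebra
qed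

text \<open>The upper bound on \<open>c\<close> says that the limit of \<open>moment_gap \<alpha> c M / M powr (\<alpha> - 2)\<close> is positive.\<close>
lemma eventually_moment_gap_pos:
  assumes "\<alpha> > 2" "0 < c" "c < 2 powr (2 - \<alpha>) * \<alpha>"
  shows "\<forall>\<^sub>F M in at_top. moment_gap \<alpha> c M > 0"
proof -
  have lim: "((\<lambda>M. moment_gap \<alpha> c M / M powr (\<alpha> - 2)) \<longlongrightarrow> 4 * \<alpha> * c - c\<^sup>2 * 2 powr \<alpha>) at_top"
    unfolding moment_gap_def using assms(1,2) by real_asymp
  have "c * 2 powr \<alpha> < 2 powr (2 - \<alpha>) * \<alpha> * 2 powr \<alpha>"
    using assms by (intro mult_strict_right_mono) auto
  also have "\<dots> = 4 * \<alpha>"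
    by (simp add: powr_diff)
  finally have "c * (c * 2 powr \<alpha>) < c * (4 * \<alpha>)"
    using \<open>0 < c\<close> by (intro mult_strict_left_mono)
  then have "4 * \<alpha> * c - c\<^sup>2 * 2 powr \<alpha> > 0"
    by (simp add: power2_eq_square algebra_simps)
  from order_tendstoD(1)[OF lim this] show ?thesis
    using eventually_gt_at_top[of 0]
    by eventually_elim (simp add: zero_less_divide_iff)
qed

section \<open>Existence of i.i.d. pairs\<close>

lemma iid_pair_product:
  fixes N :: "real measure"
  assumes "prob_space N" and sets: "sets N = sets borel"
  shows "iid_pair (N \<Otimes>\<^sub>M N) fst snd" "distr (N \<Otimes>\<^sub>M N) borel fst = N" "distr (N \<Otimes>\<^sub>M N) borel snd = N"
proof -
  interpret N: prob_space N by fact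
  interpret P: pair_prob_space N N ..
  have borel: "distr (N \<Otimes>\<^sub>M N) borel f = distr (N \<Otimes>\<^sub>M N) N f" for f
    by (rule distr_cong) (simp_all add: sets)
  show 1: "distr (N \<Otimes>\<^sub>M N) borel fst = N"
    unfolding borel by (rule N.distr_pair_fst)
  have "distr (N \<Otimes>\<^sub>M N) N snd = distr (distr (N \<Otimes>\<^sub>M N) (N \<Otimes>\<^sub>M N) (\<lambda>(x, y). (y, x))) N fst"
    by (subst distr_distr) (auto simp: comp_def case_prod_beta)
  also have "\<dots> = N"
    by (subst P.distr_pair_swap[symmetric]) (rule N.distr_pair_fst)
  finally show 2: "distr (N \<Otimes>\<^sub>M N) borel snd = N"
    unfolding borel .
  have "distr (N \<Otimes>\<^sub>M N) (borel \<Otimes>\<^sub>M borel) (\<lambda>x. (fst x, snd x)) = N \<Otimes>\<^sub>M N"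
    using distr_id2[OF sets_pair_measure_cong[OF sets sets, symmetric]] by simp
  then have "P.indep_var borel fst borel snd"
    unfolding P.indep_var_distribution_eq 1 2
    by (simp add: measurable_cong_sets[OF sets_pair_measure_cong[OF sets sets] refl])
  then show "iid_pair (N \<Otimes>\<^sub>M N) fst snd"
    by (simp add: iid_pair_def P.prob_space_axioms 1 2)
qed

lemma two_point_iid_pair_exists:
  fixes c M :: real
  assumes "0 \<le> c" "c \<le> M" "M > 0"
  obtains \<Omega> :: "(real \<times> real) measure" and X Y where
    "iid_pair \<Omega> X Y" "two_point_law \<Omega> c M X" "two_point_law \<Omega> c M Y"
proof -
  define q where "q = c / M"
  have q: "0 \<le> q" "q \<le> 1" using assms by (auto simp: q_def)
  define v where "v = (\<lambda>b. if b then - M else 1 :: real)"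
  define N where "N = distr (measure_pmf (bernoulli_pmf q)) borel v"
  have N: "prob_space N" unfolding N_def by (intro measure_pmf.prob_space_distr) simp
  have sets: "sets N = sets borel" by (simp add: N_def)
  have "v -` {1} = {False}" "v -` {- M} = {True}" using \<open>M > 0\<close> by (auto simp: v_def split: if_splits)
  then have mass: "measure N {1} = 1 - q" "measure N {- M} = q"
    using q by (simp_all add: N_def measure_distr measure_pmf_single)
  note iid = iid_pair_product[OF N sets]
  have law: "two_point_law (N \<Otimes>\<^sub>M N) c M f"
    if "distr (N \<Otimes>\<^sub>M N) borel f = N" "f \<in> borel_measurable (N \<Otimes>\<^sub>M N)" for f
  proof -
    have "measure N {x} = \<P>(\<omega> in N \<Otimes>\<^sub>M N. f \<omega> = x)" for x
      by (subst that(1)[symmetric], subst measure_distr)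
         (auto simp: that(2) intro!: arg_cong[where f = "measure _"])
    from this[of 1] this[of "- M"] show ?thesis
      using mass by (simp add: two_point_law_def q_def)
  qed
  show ?thesis
  proof
    show "iid_pair (N \<Otimes>\<^sub>M N) fst snd" by (rule iid)
    show "two_point_law (N \<Otimes>\<^sub>M N) c M fst" "two_point_law (N \<Otimes>\<^sub>M N) c M snd"
      by (auto intro!: law iid simp: measurable_cong_sets[OF sets_pair_measure_cong[OF sets sets] refl])
  qed
qed

lemma two_point_law_integrable:
  fixes h :: "real \<Rightarrow> real"
  assumes "prob_space \<Omega>" and [measurable]: "X \<in> borel_measurable \<Omega>" "h \<in> borel_measurable borel"
    and law: "two_point_law \<Omega> c M X" and "M > 0"
  shows "integrable \<Omega> (\<lambda>\<omega>. h (X \<omega>))"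
proof -
  interpret prob_space \<Omega> by fact
  show ?thesis
  proof (rule integrable_const_bound)
    show "AE \<omega> in \<Omega>. norm (h (X \<omega>)) \<le> max \<bar>h 1\<bar> \<bar>h (- M)\<bar>"
      using two_point_law_AE[OF assms(1,2) law \<open>M > 0\<close>] by eventually_elim auto
  qed measurable
qed

section \<open>Failure of the moment inequality\<close>

theorem mainTheorem3:
  fixes \<alpha> :: real
  assumes "\<alpha> > 2"
  shows "(\<forall>c::real. 0 < c \<and> c < 2 powr (2 - \<alpha>) * \<alpha> \<longrightarrow>
            (\<forall>\<^sub>F M::real in at_top.
               \<forall>(\<Omega> :: 'a measure) X Y.
                 M \<ge> c \<and> M > 0 \<and> iid_pair \<Omega> X Y \<and>
                 two_point_law \<Omega> c M X \<and> two_point_law \<Omega> c M Y \<longrightarrow>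
                 (\<integral>\<omega>. \<bar>X \<omega> - Y \<omega>\<bar> powr \<alpha> \<partial>\<Omega>)
                   - (\<integral>\<omega>. \<bar>X \<omega> + Y \<omega>\<bar> powr \<alpha> \<partial>\<Omega>) > 0)) \<and>
         (\<exists>(\<Omega> :: (real \<times> real) measure) X Y.
            iid_pair \<Omega> X Y \<and> integrable \<Omega> (\<lambda>\<omega>. \<bar>X \<omega>\<bar> powr \<alpha>) \<and>
            \<not> (\<integral>\<omega>. \<bar>X \<omega> - Y \<omega>\<bar> powr \<alpha> \<partial>\<Omega>)
                \<le> (\<integral>\<omega>. \<bar>X \<omega> + Y \<omega>\<bar> powr \<alpha> \<partial>\<Omega>))"
proof (rule conjI)
  show "\<forall>c::real. 0 < c \<and> c < 2 powr (2 - \<alpha>) * \<alpha> \<longrightarrow>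
            (\<forall>\<^sub>F M::real in at_top.
               \<forall>(\<Omega> :: 'a measure) X Y.
                 M \<ge> c \<and> M > 0 \<and> iid_pair \<Omega> X Y \<and>
                 two_point_law \<Omega> c M X \<and> two_point_law \<Omega> c M Y \<longrightarrow>
                 (\<integral>\<omega>. \<bar>X \<omega> - Y \<omega>\<bar> powr \<alpha> \<partial>\<Omega>)
                   - (\<integral>\<omega>. \<bar>X \<omega> + Y \<omega>\<bar> powr \<alpha> \<partial>\<Omega>) > 0)"
  proof (intro allI impI, elim conjE)
    fix c :: real
    assume "0 < c" "c < 2 powr (2 - \<alpha>) * \<alpha>"
    from eventually_moment_gap_pos[OF assms this] eventually_ge_at_top[of 1]
    show "\<forall>\<^sub>F M::real in at_top.
               \<forall>(\<Omega> :: 'a measure) X Y.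
                 M \<ge> c \<and> M > 0 \<and> iid_pair \<Omega> X Y \<and>
                 two_point_law \<Omega> c M X \<and> two_point_law \<Omega> c M Y \<longrightarrow>
                 (\<integral>\<omega>. \<bar>X \<omega> - Y \<omega>\<bar> powr \<alpha> \<partial>\<Omega>)
                   - (\<integral>\<omega>. \<bar>X \<omega> + Y \<omega>\<bar> powr \<alpha> \<partial>\<Omega>) > 0"
    proof eventually_elim
      case (elim M)
      then show ?case
        by (intro allI impI, elim conjE) (subst moment_gap_eq)
    qed
  qed
next
  define c where "c = 2 powr (2 - \<alpha>) * \<alpha> / 2"
  have c: "0 < c" "c < 2 powr (2 - \<alpha>) * \<alpha>" using assms by (simp_all add: c_def)
  have "\<forall>\<^sub>F M in at_top. moment_gap \<alpha> c M > 0 \<and> M \<ge> 1 \<and> M \<ge> c"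
    by (intro eventually_conj eventually_moment_gap_pos assms c eventually_ge_at_top)
  then obtain M where M: "moment_gap \<alpha> c M > 0" "M \<ge> 1" "M \<ge> c"
    using eventually_happens'[OF trivial_limit_at_top_linorder] by blast
  obtain \<Omega> :: "(real \<times> real) measure" and X Y where
    *: "iid_pair \<Omega> X Y" "two_point_law \<Omega> c M X" "two_point_law \<Omega> c M Y"
    using two_point_iid_pair_exists[of c M] c M by auto
  have ps: "prob_space \<Omega>" using *(1) by (simp add: iid_pair_def)
  then interpret prob_space \<Omega> .
  have "X \<in> borel_measurable \<Omega>"
    using *(1) by (auto simp: iid_pair_def intro: indep_var_rv1)
  then have "integrable \<Omega> (\<lambda>\<omega>. \<bar>X \<omega>\<bar> powr \<alpha>)"
    using two_point_law_integrable[OF ps _ _ *(2), of "\<lambda>x. \<bar>x\<bar> powr \<alpha>"] M by simp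
  moreover have "\<not> (\<integral>\<omega>. \<bar>X \<omega> - Y \<omega>\<bar> powr \<alpha> \<partial>\<Omega>) \<le> (\<integral>\<omega>. \<bar>X \<omega> + Y \<omega>\<bar> powr \<alpha> \<partial>\<Omega>)"
    using moment_gap_eq[OF * M(2), of \<alpha>] M(1) by simp
  ultimately show "\<exists>(\<Omega> :: (real \<times> real) measure) X Y.
            iid_pair \<Omega> X Y \<and> integrable \<Omega> (\<lambda>\<omega>. \<bar>X \<omega>\<bar> powr \<alpha>) \<and>
            \<not> (\<integral>\<omega>. \<bar>X \<omega> - Y \<omega>\<bar> powr \<alpha> \<partial>\<Omega>)
                \<le> (\<integral>\<omega>. \<bar>X \<omega> + Y \<omega>\<bar> powr \<alpha> \<partial>\<Omega>)"
    using *(1) by blast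
qed

end
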